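(* $E^{ce}_{\mathrm{set}}\not\leq_cE^{ce}_3$.
   Context: $W_e$ is the $e$-th c.e. set; $A^{[n]}=\{x:\langle x,n\rangle\in A\}$ is the $n$-th column of $A\subseteq\omega$. $i\,E^{ce}_{\mathrm{set}}\,j\iff\{W_i^{[n]}:n\in\omega\}=\{W_j^{[n]}:n\in\omega\}$. $i\,E^{ce}_3\,j\iff$ for every $n$, $W_i^{[n]}\triangle W_j^{[n]}$ is finite. $E\leq_cF$ means there is a total computable $g$ with $x\,E\,y\iff g(x)\,F\,g(y)$ for all $x,y$. *)

theory Defs
  imports Main "HOL-Library.Nat_Bijection"
begin

datatype recf =
    Zero
  | Succ
  | Proj nat
  | Comp recf "recf list"
  | PrimRec recf recf
  | Minim recf

lemma list_all2_mono_ind [mono]: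
  "(\<And>x y. P x y \<longrightarrow> Q x y) \<Longrightarrow> list_all2 P xs ys \<longrightarrow> list_all2 Q xs ys"
  by (auto elim: list_all2_mono)

inductive eval :: "recf \<Rightarrow> nat list \<Rightarrow> nat \<Rightarrow> bool" where
  eval_Zero: "eval Zero xs 0"
| eval_Succ: "eval Succ (x # xs) (Suc x)"
| eval_Proj: "i < length xs \<Longrightarrow> eval (Proj i) xs (xs ! i)"
| eval_Comp: "list_all2 (\<lambda>g y. eval g xs y) gs ys \<Longrightarrow> eval f ys z \<Longrightarrow> eval (Comp f gs) xs z"
| eval_PrimRec0: "eval f xs z \<Longrightarrow> eval (PrimRec f g) (0 # xs) z"
| eval_PrimRecS: "eval (PrimRec f g) (n # xs) y \<Longrightarrow> eval g (n # y # xs) z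
                   \<Longrightarrow> eval (PrimRec f g) (Suc n # xs) z"
| eval_Minim: "eval f (n # xs) 0 \<Longrightarrow> (\<forall>m<n. \<exists>y. eval f (m # xs) (Suc y))
                 \<Longrightarrow> eval (Minim f) xs n"

fun code_list :: "nat list \<Rightarrow> nat" where
  "code_list [] = 0"
| "code_list (x # xs) = Suc (prod_encode (x, code_list xs))"

primrec code :: "recf \<Rightarrow> nat" where
  "code Zero = prod_encode (0, 0)"
| "code Succ = prod_encode (1, 0)"
| "code (Proj i) = prod_encode (2, i)"
| "code (Comp f gs) = prod_encode (3, prod_encode (code f, code_list (map code gs)))"
| "code (PrimRec f g) = prod_encode (4, prod_encode (code f, code g))"
| "code (Minim f) = prod_encode (5, code f)"

definition prog :: "nat \<Rightarrow> recf" where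
  "prog e = (if e \<in> range code then inv code e else Zero)"

definition W :: "nat \<Rightarrow> nat set" where
  "W e = {x. \<exists>z. eval (prog e) [x] z}"

definition computable :: "(nat \<Rightarrow> nat) \<Rightarrow> bool" where
  "computable g \<longleftrightarrow> (\<exists>r. \<forall>x. eval r [x] (g x))"

definition column :: "nat set \<Rightarrow> nat \<Rightarrow> nat set" where
  "column A n = {x. prod_encode (x, n) \<in> A}"

definition Ece_set :: "nat \<Rightarrow> nat \<Rightarrow> bool" where
  "Ece_set i j \<longleftrightarrow> range (column (W i)) = range (column (W j))"

definition Ece_3 :: "nat \<Rightarrow> nat \<Rightarrow> bool" where
  "Ece_3 i j \<longleftrightarrow> (\<forall>n. finite ((column (W i) n - column (W j) n) \<union> (column (W j) n - column (W i) n)))"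

definition comp_reducible :: "(nat \<Rightarrow> nat \<Rightarrow> bool) \<Rightarrow> (nat \<Rightarrow> nat \<Rightarrow> bool) \<Rightarrow> bool" where
  "comp_reducible E F \<longleftrightarrow> (\<exists>g. computable g \<and> (\<forall>x y. E x y \<longleftrightarrow> F (g x) (g y)))"

end

theory Submission
  imports Defs
begin

text \<open>Let \<open>g\<close> be a reduction. Take \<open>b\<close> whose columns are the finite initial segments of the
  natural numbers, and \<open>a\<close> with the full set as one further column. Then \<open>g a\<close> and \<open>g b\<close> differ
  infinitely often in some column \<open>n\<close>. That the \<open>n\<close>-th columns of \<open>g c\<close> and \<open>g b\<close> agree beyond
  some \<open>k\<close> is a \<open>\<Pi>\<^sub>2\<close> condition for each \<open>k\<close>, so the recursion theorem gives an index \<open>c\<close> whose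
  columns are the finite initial segments together with one initial segment for each \<open>k\<close> that is
  infinite precisely when this agreement holds. Hence \<open>c\<close> is equivalent to \<open>a\<close> if \<open>g c\<close> and \<open>g b\<close>
  almost agree in column \<open>n\<close> and to \<open>b\<close> otherwise; both cases contradict the choice of \<open>n\<close>.\<close>

section \<open>Evaluation is deterministic and programs are determined by their codes\<close>

inductive_cases eval_ZeroE: "eval Zero xs z"
inductive_cases eval_SuccE: "eval Succ xs z"
inductive_cases eval_ProjE: "eval (Proj i) xs z"
inductive_cases eval_CompE: "eval (Comp f gs) xs z"
inductive_cases eval_MinimE: "eval (Minim f) xs z"

text \<open>For \<open>Minim\<close>, two different results would make the smaller one an argument
  at which \<open>f\<close> has both a zero and a positive value.\<close>

lemma eval_deterministic: "eval f xs y \<Longrightarrow> eval f xs z \<Longrightarrow> y = z"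
proof (induction arbitrary: z rule: eval.induct)
  case (eval_Comp xs gs ys f w)
  from eval_Comp.prems obtain ys' where
    ys': "list_all2 (\<lambda>g y. eval g xs y) gs ys'" "eval f ys' z"
    by (rule eval_CompE)
  have "ys = ys'"
  proof (rule nth_equalityI)
    show "length ys = length ys'"
      using list_all2_lengthD[OF eval_Comp.IH(1)] list_all2_lengthD[OF ys'(1)] by simp
    fix i assume "i < length ys"
    then have "i < length gs" using list_all2_lengthD[OF eval_Comp.IH(1)] by simp
    then show "ys ! i = ys' ! i"
      using list_all2_nthD[OF eval_Comp.IH(1)] list_all2_nthD[OF ys'(1)] by blast
  qed
  then show ?case using eval_Comp.IH(2) ys'(2) by blast
next
  case (eval_PrimRec0 f xs w g)
  from eval_PrimRec0.prems have "eval f xs z" by (cases rule: eval.cases) auto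
  then show ?case by (rule eval_PrimRec0.IH)
next
  case (eval_PrimRecS f g n xs y w)
  from eval_PrimRecS.prems obtain y' where
    "eval (PrimRec f g) (n # xs) y'" "eval g (n # y' # xs) z"
    by (cases rule: eval.cases) auto
  then show ?case using eval_PrimRecS.IH by blast
next
  case (eval_Minim f n xs)
  from eval_Minim.prems have z: "eval f (z # xs) 0" "\<forall>m<z. \<exists>y. eval f (m # xs) (Suc y)"
    by (blast elim: eval_MinimE)+
  show ?case
  proof (cases n z rule: linorder_cases)
    case less
    then obtain y where "eval f (n # xs) (Suc y)" using z(2) by blast
    then show ?thesis using eval_Minim.IH(1) by blast
  next
    case greater
    then obtain y where "\<And>w. eval f (z # xs) w \<Longrightarrow> Suc y = w" using eval_Minim.IH(2) by blast
    then show ?thesis using z(1) by blast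
  qed
next
  case eval_Zero
  then show ?case by (auto elim: eval_ZeroE)
next
  case eval_Succ
  then show ?case by (auto elim: eval_SuccE)
next
  case eval_Proj
  then show ?case by (auto elim: eval_ProjE)
qed

lemma code_list_inject [simp]: "code_list xs = code_list ys \<longleftrightarrow> xs = ys"
proof (induction xs arbitrary: ys)
  case Nil
  then show ?case by (cases ys) auto
next
  case (Cons x xs)
  then show ?case by (cases ys) auto
qed

lemma code_inject [simp]: "code f = code g \<longleftrightarrow> f = g"
proof (induction f arbitrary: g)
  case (Comp f fs)
  have "map code fs = map code gs \<longleftrightarrow> fs = gs" for gs
    using Comp.IH(2) by (auto simp: list_eq_iff_nth_eq)
  then show ?case using Comp.IH(1) by (cases g) auto
next
  case Zero show ?case by (cases g) auto
next
  case Succ show ?case by (cases g) auto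
next
  case (Proj i) show ?case by (cases g) auto
next
  case (PrimRec f h) then show ?case by (cases g) auto
next
  case (Minim f) then show ?case by (cases g) auto
qed

lemma prog_code [simp]: "prog (code f) = f"
  by (simp add: prog_def inj_def)

section \<open>Recursive functions and decidable predicates of several variables\<close>

text \<open>Variables are positions of an environment list of length \<open>k\<close>, so that
  closure properties apply directly to lambda terms. A bound variable is put in front, and outer
  variables are then seen through \<open>drop\<close>.\<close>

definition recursive :: "nat \<Rightarrow> (nat list \<Rightarrow> nat) \<Rightarrow> bool" where
  "recursive k f \<longleftrightarrow> (\<exists>r. \<forall>xs. length xs = k \<longrightarrow> eval r xs (f xs))"

definition decidable :: "nat \<Rightarrow> (nat list \<Rightarrow> bool) \<Rightarrow> bool" where
  "decidable k P \<longleftrightarrow> recursive k (\<lambda>e. of_bool (P e))"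

lemma recursive_cong:
  assumes "recursive k f" and "\<And>e. length e = k \<Longrightarrow> f e = g e"
  shows "recursive k g"
  using assms by (auto simp: recursive_def)

lemma recursive_compose:
  assumes "recursive (length fs) h" and "\<And>f. f \<in> set fs \<Longrightarrow> recursive k f"
  shows "recursive k (\<lambda>e. h (map (\<lambda>f. f e) fs))"
proof -
  obtain r where r: "\<And>xs. length xs = length fs \<Longrightarrow> eval r xs (h xs)"
    using assms(1) by (auto simp: recursive_def)
  have "\<forall>f\<in>set fs. \<exists>r. \<forall>xs. length xs = k \<longrightarrow> eval r xs (f xs)"
    using assms(2) by (auto simp: recursive_def)
  then obtain s where s: "\<And>f xs. f \<in> set fs \<Longrightarrow> length xs = k \<Longrightarrow> eval (s f) xs (f xs)"
    by metis
  have "eval (Comp r (map s fs)) xs (h (map (\<lambda>f. f xs) fs))" if "length xs = k" for xs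
    by (rule eval_Comp[of _ _ "map (\<lambda>f. f xs) fs"]) (auto simp: list_all2_conv_all_nth r s that)
  then show ?thesis by (auto simp: recursive_def)
qed

lemma recursive_compose1:
  assumes "recursive 1 (\<lambda>e. h (e ! 0))" "recursive k f"
  shows "recursive k (\<lambda>e. h (f e))"
  using recursive_compose[of "[f]" "\<lambda>e. h (e ! 0)" k] assms by simp

lemma recursive_compose3:
  assumes "recursive 3 (\<lambda>e. h (e ! 0) (e ! 1) (e ! 2))"
    and "recursive k f1" "recursive k f2" "recursive k f3"
  shows "recursive k (\<lambda>e. h (f1 e) (f2 e) (f3 e))"
proof -
  have "recursive k (\<lambda>e. (\<lambda>e. h (e ! 0) (e ! 1) (e ! 2)) (map (\<lambda>f. f e) [f1, f2, f3]))"
    by (rule recursive_compose) (use assms in \<open>auto simp: numeral_3_eq_3\<close>)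
  then show ?thesis by simp
qed

lemma recursive_nth: "i < k \<Longrightarrow> recursive k (\<lambda>e. e ! i)"
  unfolding recursive_def by (metis eval_Proj)

text \<open>This and the next lemma match the terms that an outer variable turns into below one or
  two binders.\<close>

lemma recursive_nth_drop: "m + i < k \<Longrightarrow> recursive k (\<lambda>e. drop m e ! i)"
  by (rule recursive_cong[OF recursive_nth[of "m + i"]]) auto

lemma recursive_nth_drop2: "m + n + i < k \<Longrightarrow> recursive k (\<lambda>e. drop m (drop n e) ! i)"
  by (rule recursive_cong[OF recursive_nth_drop[of "m + n" i]]) auto

lemma recursive_Suc:
  assumes "recursive k f"
  shows "recursive k (\<lambda>e. Suc (f e))"
proof (rule recursive_compose1[OF _ assms])
  have "eval Succ xs (Suc (xs ! 0))" if "length xs = 1" for xs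
    using that by (cases xs) (auto intro: eval_Succ)
  then show "recursive 1 (\<lambda>e. Suc (e ! 0))" by (auto simp: recursive_def)
qed

lemma recursive_const: "recursive k (\<lambda>e. c)"
proof (induction c)
  case 0
  show ?case by (auto simp: recursive_def intro: eval_Zero)
next
  case (Suc c)
  then show ?case by (rule recursive_Suc)
qed

lemma recursive_rec_nat:
  assumes "recursive k a" "recursive k n"
    and "recursive (k + 2) (\<lambda>e. b (e ! 0) (e ! 1) (drop 2 e))"
  shows "recursive k (\<lambda>e. rec_nat (a e) (\<lambda>i r. b i r e) (n e))"
proof -
  obtain ra where ra: "\<And>xs. length xs = k \<Longrightarrow> eval ra xs (a xs)"
    using assms(1) by (auto simp: recursive_def)
  obtain rb where rb: "\<And>xs. length xs = k + 2 \<Longrightarrow> eval rb xs (b (xs ! 0) (xs ! 1) (drop 2 xs))"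
    using assms(3) by (auto simp: recursive_def)
  have step: "eval (PrimRec ra rb) (m # xs) (rec_nat (a xs) (\<lambda>i r. b i r xs) m)"
    if "length xs = k" for m xs
  proof (induction m)
    case 0
    show ?case using ra[OF that] by (auto intro: eval_PrimRec0)
  next
    case (Suc m)
    show ?case
      using eval_PrimRecS[OF Suc, of "b m (rec_nat (a xs) (\<lambda>i r. b i r xs) m) xs"]
        rb[of "m # rec_nat (a xs) (\<lambda>i r. b i r xs) m # xs"] that by simp
  qed
  let ?h = "\<lambda>e. rec_nat (a (tl e)) (\<lambda>i r. b i r (tl e)) (hd e)"
  \<comment> \<open>The projections copy the environment, and \<open>n\<close> goes in front because
    \<open>PrimRec\<close> recurses on its first argument.\<close>
  let ?fs = "n # map (\<lambda>i e. e ! i) [0..<k]"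
  have "recursive (length ?fs) ?h"
    unfolding recursive_def
  proof (intro exI allI impI)
    fix xs :: "nat list" assume "length xs = length ?fs"
    then show "eval (PrimRec ra rb) xs (?h xs)"
      using step by (cases xs) auto
  qed
  then have "recursive k (\<lambda>e. ?h (map (\<lambda>f. f e) ?fs))"
    by (rule recursive_compose) (auto intro: recursive_nth assms)
  moreover have "map (\<lambda>i. e ! i) [0..<k] = e" if "length e = k" for e :: "nat list"
    using map_nth[of e] that by simp
  ultimately show ?thesis
    by (elim recursive_cong) (simp add: comp_def)
qed

text \<open>Composition with projections that skip the positions from \<open>m\<close> to
  \<open>m + j - 1\<close>. The case \<open>m = 0\<close> adds variables in front;
  \<open>m = j = 1\<close> lets a summand see the index of a sum but not the accumulator of the
  recursion.\<close>

lemma recursive_shift: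
  assumes "recursive (k + m) (\<lambda>e. f (take m e) (drop m e))"
  shows "recursive (k + m + j) (\<lambda>e. f (take m e) (drop (m + j) e))"
proof -
  let ?fs = "map (\<lambda>i e. e ! i) ([0..<m] @ [m + j..<k + m + j])"
  have "recursive (k + m + j) (\<lambda>e. (\<lambda>e. f (take m e) (drop m e)) (map (\<lambda>f. f e) ?fs))"
    by (rule recursive_compose) (use assms in \<open>auto simp: add.commute intro: recursive_nth\<close>)
  then show ?thesis
  proof (rule recursive_cong)
    fix e :: "nat list" assume e: "length e = k + m + j"
    have "map (\<lambda>f. f e) ?fs = take m e @ drop (m + j) e"
      by (rule nth_equalityI) (auto simp: e nth_append)
    then show "f (take m (map (\<lambda>f. f e) ?fs)) (drop m (map (\<lambda>f. f e) ?fs))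
      = f (take m e) (drop (m + j) e)" using e by simp
  qed
qed

lemma recursive_weaken: "recursive k f \<Longrightarrow> recursive (k + j) (\<lambda>e. f (drop j e))"
  using recursive_shift[of k 0 "\<lambda>_. f" j] by simp

section \<open>Arithmetic, decidable predicates and bounded quantifiers\<close>

lemma recursive_add:
  assumes "recursive k f" "recursive k g"
  shows "recursive k (\<lambda>e. f e + g e)"
proof -
  have "recursive k (\<lambda>e. rec_nat (f e) (\<lambda>i r. Suc r) (g e))"
    by (intro recursive_rec_nat assms recursive_Suc recursive_nth) simp
  moreover have "rec_nat a (\<lambda>i r. Suc r) b = a + b" for a b :: nat
    by (induction b) auto
  ultimately show ?thesis by simp
qed

lemma recursive_mult:
  assumes "recursive k f" "recursive k g"
  shows "recursive k (\<lambda>e. f e * g e)"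
proof -
  have "recursive k (\<lambda>e. rec_nat 0 (\<lambda>i r. r + f e) (g e))"
    by (intro recursive_rec_nat recursive_const assms recursive_add recursive_nth recursive_weaken) simp
  moreover have "rec_nat 0 (\<lambda>i r. r + a) b = a * b" for a b :: nat
    by (induction b) auto
  ultimately show ?thesis by simp
qed

lemma recursive_diff:
  assumes "recursive k f" "recursive k g"
  shows "recursive k (\<lambda>e. f e - g e)"
proof -
  have pred: "recursive j (\<lambda>e. h e - 1)" if "recursive j h" for j h
  proof -
    have "recursive j (\<lambda>e. rec_nat 0 (\<lambda>i r. i) (h e))"
      by (intro recursive_rec_nat recursive_const that recursive_nth) simp
    moreover have "rec_nat 0 (\<lambda>i r. i) b = b - 1" for b :: nat
      by (cases b) auto
    ultimately show ?thesis by simp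
  qed
  have "recursive k (\<lambda>e. rec_nat (f e) (\<lambda>i r. r - 1) (g e))"
    by (intro recursive_rec_nat assms pred recursive_nth) simp
  moreover have "rec_nat a (\<lambda>i r. r - 1) b = a - b" for a b :: nat
    by (induction b) auto
  ultimately show ?thesis by simp
qed

lemma recursive_of_bool: "decidable k P \<Longrightarrow> recursive k (\<lambda>e. of_bool (P e))"
  by (simp add: decidable_def)

lemma recursive_if:
  assumes "decidable k P" "recursive k f" "recursive k g"
  shows "recursive k (\<lambda>e. if P e then f e else g e)"
proof -
  have "recursive k (\<lambda>e. of_bool (P e) * f e + (1 - of_bool (P e)) * g e)"
    by (intro recursive_add recursive_mult recursive_diff recursive_const recursive_of_bool assms)
  then show ?thesis by (rule recursive_cong) auto
qed

lemma decidable_less: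
  assumes "recursive k f" "recursive k g"
  shows "decidable k (\<lambda>e. f e < g e)"
proof -
  \<comment> \<open>With truncated subtraction, \<open>1 - (1 - d)\<close> is the sign of
    \<open>d\<close>.\<close>
  have "recursive k (\<lambda>e. 1 - (1 - (g e - f e)))"
    by (intro recursive_diff recursive_const assms)
  then show ?thesis unfolding decidable_def by (rule recursive_cong) auto
qed

lemma decidable_not:
  assumes "decidable k P"
  shows "decidable k (\<lambda>e. \<not> P e)"
proof -
  have "recursive k (\<lambda>e. 1 - of_bool (P e))"
    by (intro recursive_diff recursive_const recursive_of_bool assms)
  then show ?thesis unfolding decidable_def by (rule recursive_cong) auto
qed

lemma decidable_conj:
  assumes "decidable k P" "decidable k Q"
  shows "decidable k (\<lambda>e. P e \<and> Q e)"
proof -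
  have "recursive k (\<lambda>e. of_bool (P e) * of_bool (Q e))"
    by (intro recursive_mult recursive_of_bool assms)
  then show ?thesis unfolding decidable_def by (rule recursive_cong) auto
qed

lemma decidable_disj:
  assumes "decidable k P" "decidable k Q"
  shows "decidable k (\<lambda>e. P e \<or> Q e)"
  using decidable_not[OF decidable_conj[OF decidable_not decidable_not], OF assms] by simp

lemma decidable_imp:
  assumes "decidable k P" "decidable k Q"
  shows "decidable k (\<lambda>e. P e \<longrightarrow> Q e)"
  using decidable_disj[OF decidable_not, OF assms] by (simp only: imp_conv_disj)

lemma decidable_eq:
  assumes "recursive k f" "recursive k g"
  shows "decidable k (\<lambda>e. f e = g e)"
proof -
  have "decidable k (\<lambda>e. \<not> f e < g e \<and> \<not> g e < f e)"
    by (intro decidable_conj decidable_not decidable_less assms)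
  moreover have "(\<not> a < b \<and> \<not> b < a) = (a = b)" for a b :: nat by auto
  ultimately show ?thesis by simp
qed

lemma recursive_sum:
  assumes "recursive k n" "recursive (k + 1) (\<lambda>e. b (e ! 0) (drop 1 e))"
  shows "recursive k (\<lambda>e. \<Sum>i<n e. b i e)"
proof -
  have "recursive (k + 1) (\<lambda>e. b (take 1 e ! 0) (drop 1 e))"
    by (rule recursive_cong[OF assms(2)]) simp
  from recursive_shift[OF this, of 1] have "recursive (k + 2) (\<lambda>e. b (e ! 0) (drop 2 e))"
    by (simp add: numeral_2_eq_2)
  then have "recursive k (\<lambda>e. rec_nat 0 (\<lambda>i r. r + b i e) (n e))"
    by (intro recursive_rec_nat recursive_const assms recursive_add recursive_nth) simp_all
  moreover have "rec_nat 0 (\<lambda>i r. r + b i e) m = (\<Sum>i<m. b i e)" for m e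
    by (induction m) auto
  ultimately show ?thesis by simp
qed

lemma decidable_bex:
  assumes "recursive k n" "decidable (k + 1) (\<lambda>e. P (e ! 0) (drop 1 e))"
  shows "decidable k (\<lambda>e. \<exists>i<n e. P i e)"
proof -
  have "decidable k (\<lambda>e. 0 < (\<Sum>i<n e. of_bool (P i e) :: nat))"
    by (intro decidable_less recursive_const recursive_sum recursive_of_bool assms)
  moreover have "0 < (\<Sum>i<m. of_bool (P i e) :: nat) \<longleftrightarrow> (\<exists>i<m. P i e)" for m e
    by (auto simp: card_gt_0_iff)
  ultimately show ?thesis by simp
qed

lemma decidable_ball:
  assumes "recursive k n" "decidable (k + 1) (\<lambda>e. P (e ! 0) (drop 1 e))"
  shows "decidable k (\<lambda>e. \<forall>i<n e. P i e)"
  using decidable_not[OF decidable_bex[OF assms(1) decidable_not[OF assms(2)]]] by simp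

lemma recursive_div2:
  assumes "recursive k f"
  shows "recursive k (\<lambda>e. f e div 2)"
proof -
  \<comment> \<open>Halving satisfies \<open>Suc m div 2 = m - m div 2\<close>.\<close>
  have "recursive k (\<lambda>e. rec_nat 0 (\<lambda>i r. i - r) (f e))"
    by (intro recursive_rec_nat recursive_const recursive_diff recursive_nth assms) simp_all
  moreover have "rec_nat 0 (\<lambda>i r. i - r) m = m div 2" for m :: nat
    by (induction m) auto
  ultimately show ?thesis by simp
qed

lemma decidable_odd:
  assumes "recursive k f"
  shows "decidable k (\<lambda>e. odd (f e))"
proof -
  have "decidable k (\<lambda>e. f e - 2 * (f e div 2) = 1)"
    by (intro decidable_eq recursive_const recursive_diff recursive_mult recursive_div2 assms)
  moreover have "(m - 2 * (m div 2) = 1) = odd m" for m :: nat by presburger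
  ultimately show ?thesis by simp
qed

lemma recursive_power2:
  assumes "recursive k f"
  shows "recursive k (\<lambda>e. 2 ^ f e)"
proof -
  have "recursive k (\<lambda>e. rec_nat 1 (\<lambda>i r. 2 * r) (f e))"
    by (intro recursive_rec_nat recursive_const recursive_mult recursive_nth assms) simp_all
  moreover have "rec_nat (Suc 0) (\<lambda>i r. 2 * r) m = 2 ^ m" for m :: nat
    by (induction m) auto
  ultimately show ?thesis by simp
qed

text \<open>Membership is the value of one binary digit: halve repeatedly, then test the
  parity.\<close>

lemma decidable_set_decode:
  assumes "recursive k f" "recursive k g"
  shows "decidable k (\<lambda>e. f e \<in> set_decode (g e))"
proof -
  have "decidable k (\<lambda>e. odd (rec_nat (g e) (\<lambda>i r. r div 2) (f e)))"
    by (intro decidable_odd recursive_rec_nat recursive_div2 recursive_nth assms) simp_all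
  moreover have "rec_nat m (\<lambda>i r. r div 2) n = m div 2 ^ n" for m n :: nat
    by (induction n) (auto simp: div_mult2_eq power_Suc2 simp del: power_Suc)
  ultimately show ?thesis by (simp add: set_decode_def)
qed

lemma recursive_prod_encode:
  assumes "recursive k f" "recursive k g"
  shows "recursive k (\<lambda>e. prod_encode (f e, g e))"
proof -
  have "recursive k (\<lambda>e. (f e + g e) * Suc (f e + g e) div 2 + f e)"
    by (intro recursive_add recursive_div2 recursive_mult recursive_Suc assms)
  then show ?thesis by (simp add: prod_encode_def triangle_def)
qed

section \<open>Computability of unpairing\<close>

abbreviation pfst :: "nat \<Rightarrow> nat" where "pfst u \<equiv> fst (prod_decode u)"
abbreviation psnd :: "nat \<Rightarrow> nat" where "psnd u \<equiv> snd (prod_decode u)"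

text \<open>Bounded search written as a sum with a single contributing summand; the bound suffices
  because both components are at most the code of the pair.\<close>

lemma sum_prod_encode_eq:
  "(\<Sum>i<Suc u. \<Sum>j<Suc u. if prod_encode (i, j) = u then f i j else (0::nat)) = f (pfst u) (psnd u)"
proof -
  obtain a b where u: "u = prod_encode (a, b)"
    by (metis prod_decode_inverse surj_pair)
  have ab: "a < Suc u" "b < Suc u"
    using u le_prod_encode_1[of a b] le_prod_encode_2[of b a] by auto
  have "(\<Sum>j<Suc u. if prod_encode (i, j) = u then f i j else 0) = (if i = a then f a b else 0)" for i
    using ab by (auto simp: u sum.delta simp del: sum.lessThan_Suc)
  then have "(\<Sum>i<Suc u. \<Sum>j<Suc u. if prod_encode (i, j) = u then f i j else 0)
    = (\<Sum>i<Suc u. if i = a then f a b else 0)" by simp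
  also have "\<dots> = f a b" using ab by (simp add: sum.delta del: sum.lessThan_Suc)
  finally show ?thesis using u by simp
qed

lemma recursive_prod_decode:
  assumes "recursive k f"
  shows recursive_pfst: "recursive k (\<lambda>e. pfst (f e))"
    and recursive_psnd: "recursive k (\<lambda>e. psnd (f e))"
proof -
  note intros = recursive_sum recursive_if decidable_eq recursive_prod_encode recursive_nth
    recursive_nth_drop recursive_nth_drop2 recursive_const recursive_Suc
  have "recursive 1 (\<lambda>e. \<Sum>i<Suc (e ! 0). \<Sum>j<Suc (e ! 0). if prod_encode (i, j) = e ! 0 then i else 0)"
    by (intro intros) simp_all
  then have "recursive 1 (\<lambda>e. pfst (e ! 0))"
    by (simp only: sum_prod_encode_eq[of _ "\<lambda>i j. i"])
  then show "recursive k (\<lambda>e. pfst (f e))" by (rule recursive_compose1) (rule assms)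
  have "recursive 1 (\<lambda>e. \<Sum>i<Suc (e ! 0). \<Sum>j<Suc (e ! 0). if prod_encode (i, j) = e ! 0 then j else 0)"
    by (intro intros) simp_all
  then have "recursive 1 (\<lambda>e. psnd (e ! 0))"
    by (simp only: sum_prod_encode_eq[of _ "\<lambda>i j. j"])
  then show "recursive k (\<lambda>e. psnd (f e))" by (rule recursive_compose1) (rule assms)
qed

lemmas recursive_intros =
  recursive_rec_nat recursive_if recursive_add recursive_mult recursive_diff recursive_Suc
  recursive_const recursive_nth recursive_nth_drop recursive_nth_drop2 recursive_div2
  recursive_power2 recursive_prod_encode recursive_pfst recursive_psnd
  decidable_less decidable_eq decidable_not decidable_conj decidable_disj decidable_imp
  decidable_bex decidable_ball decidable_odd decidable_set_decode

section \<open>A recursive enumeration of the evaluation relation\<close>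

text \<open>These act on values of \<open>code_list\<close>. The empty list has code 0, so
  \<open>0 < x\<close> below says that the list \<open>x\<close> is nonempty.\<close>

abbreviation lcons :: "nat \<Rightarrow> nat \<Rightarrow> nat" where "lcons a l \<equiv> Suc (prod_encode (a, l))"
abbreviation lhd :: "nat \<Rightarrow> nat" where "lhd l \<equiv> pfst (l - 1)"
abbreviation ltl :: "nat \<Rightarrow> nat" where "ltl l \<equiv> psnd (l - 1)"
abbreviation judg :: "nat \<Rightarrow> nat \<Rightarrow> nat \<Rightarrow> nat" where
  "judg e x z \<equiv> prod_encode (e, prod_encode (x, z))"

text \<open>\<open>step e x z p q\<close> says that the judgement ``program \<open>e\<close> on the argument list \<open>x\<close> yields \<open>z\<close>''
  follows from the judgements \<open>p\<close> and \<open>q\<close>. Besides the tags of \<^const>\<open>code\<close> there are two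
  auxiliary ones, so that two premises always suffice: tag 6 evaluates a list of programs, and
  tag 7 with \<open>prod_encode (f, n)\<close> states that \<open>f\<close> is positive at all arguments below \<open>n\<close>.
  Argument lists are unravelled by the rule for projections itself.\<close>

definition step :: "nat \<Rightarrow> nat \<Rightarrow> nat \<Rightarrow> nat \<Rightarrow> nat \<Rightarrow> bool" where
  "step e x z p q \<longleftrightarrow>
    (pfst e = 0 \<and> z = 0)
  \<or> (pfst e = 1 \<and> 0 < x \<and> z = Suc (lhd x))
  \<or> (pfst e = 2 \<and> 0 < x \<and> psnd e = 0 \<and> z = lhd x)
  \<or> (pfst e = 2 \<and> 0 < x \<and> 0 < psnd e \<and> p = judg (prod_encode (2, psnd e - 1)) (ltl x) z)
  \<or> (pfst e = 3 \<and> p = judg (prod_encode (6, psnd (psnd e))) x (psnd (psnd p))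
      \<and> q = judg (pfst (psnd e)) (psnd (psnd p)) z)
  \<or> (pfst e = 4 \<and> 0 < x \<and> lhd x = 0 \<and> p = judg (pfst (psnd e)) (ltl x) z)
  \<or> (pfst e = 4 \<and> 0 < x \<and> 0 < lhd x \<and> p = judg e (lcons (lhd x - 1) (ltl x)) (psnd (psnd p))
      \<and> q = judg (psnd (psnd e)) (lcons (lhd x - 1) (lcons (psnd (psnd p)) (ltl x))) z)
  \<or> (pfst e = 5 \<and> p = judg (psnd e) (lcons z x) 0
      \<and> q = judg (prod_encode (7, prod_encode (psnd e, z))) x 0)
  \<or> (pfst e = 6 \<and> psnd e = 0 \<and> z = 0)
  \<or> (pfst e = 6 \<and> 0 < psnd e \<and> 0 < z \<and> p = judg (lhd (psnd e)) x (lhd z)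
      \<and> q = judg (prod_encode (6, ltl (psnd e))) x (ltl z))
  \<or> (pfst e = 7 \<and> psnd (psnd e) = 0)
  \<or> (pfst e = 7 \<and> 0 < psnd (psnd e)
      \<and> p = judg (prod_encode (7, prod_encode (pfst (psnd e), psnd (psnd e) - 1))) x z
      \<and> q = judg (pfst (psnd e)) (lcons (psnd (psnd e) - 1) x) (psnd (psnd q))
      \<and> 0 < psnd (psnd q))"

text \<open>The judgement \<open>0\<close>, that is \<^const>\<open>Zero\<close> on the empty list yields \<open>0\<close>, serves as a dummy
  premise.\<close>

inductive derivable :: "nat \<Rightarrow> bool" where
  derivable_0: "derivable 0"
| derivable_step: "derivable p \<Longrightarrow> derivable q \<Longrightarrow>
    step (pfst t) (pfst (psnd t)) (psnd (psnd t)) p q \<Longrightarrow> derivable t"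

section \<open>Completeness: every evaluation is derivable\<close>

lemma derivable_judg:
  "step e x z p q \<Longrightarrow> derivable p \<Longrightarrow> derivable q \<Longrightarrow> derivable (judg e x z)"
  by (rule derivable_step) auto

lemma derivable_Proj:
  "i < length xs \<Longrightarrow> derivable (judg (prod_encode (2, i)) (code_list xs) (xs ! i))"
proof (induction xs arbitrary: i)
  case (Cons x xs)
  show ?case
  proof (cases i)
    case 0
    then show ?thesis
      by (intro derivable_judg[OF _ derivable_0 derivable_0]) (simp add: step_def)
  next
    case (Suc j)
    then have "derivable (judg (prod_encode (2, j)) (code_list xs) (xs ! j))"
      using Cons by simp
    from derivable_judg[OF _ this derivable_0] show ?thesis
      using Suc by (simp add: step_def)
  qed
qed simp

lemma derivable_list:
  "list_all2 (\<lambda>g y. derivable (judg (code g) x y)) gs ys \<Longrightarrow>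
    derivable (judg (prod_encode (6, code_list (map code gs))) x (code_list ys))"
proof (induction rule: list_all2_induct)
  case Nil
  show ?case by (intro derivable_judg[OF _ derivable_0 derivable_0]) (simp add: step_def)
next
  case (Cons g gs y ys)
  show ?case by (rule derivable_judg[OF _ Cons(1) Cons(3)]) (simp add: step_def)
qed

lemma derivable_positive:
  "\<forall>m<n. \<exists>y. derivable (judg f (lcons m x) (Suc y)) \<Longrightarrow>
    derivable (judg (prod_encode (7, prod_encode (f, n))) x 0)"
proof (induction n)
  case 0
  show ?case by (intro derivable_judg[OF _ derivable_0 derivable_0]) (simp add: step_def)
next
  case (Suc n)
  then obtain y where y: "derivable (judg f (lcons n x) (Suc y))" by auto
  have "derivable (judg (prod_encode (7, prod_encode (f, n))) x 0)"
    using Suc by auto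
  from derivable_judg[OF _ this y] show ?case by (simp add: step_def)
qed

lemma derivable_complete: "eval f xs z \<Longrightarrow> derivable (judg (code f) (code_list xs) z)"
proof (induction rule: eval.induct)
  case (eval_Zero xs)
  show ?case by (intro derivable_judg[OF _ derivable_0 derivable_0]) (simp add: step_def)
next
  case (eval_Succ x xs)
  show ?case by (intro derivable_judg[OF _ derivable_0 derivable_0]) (simp add: step_def)
next
  case (eval_Proj i xs)
  then show ?case by (simp add: derivable_Proj)
next
  case (eval_Comp xs gs ys f z)
  have "list_all2 (\<lambda>g y. derivable (judg (code g) (code_list xs) y)) gs ys"
    using eval_Comp.IH(1) by (rule list_all2_mono) simp
  from derivable_judg[OF _ derivable_list[OF this] eval_Comp.IH(2)] show ?case
    by (simp add: step_def)
next
  case (eval_PrimRec0 f xs z g)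
  from derivable_judg[OF _ eval_PrimRec0.IH derivable_0] show ?case by (simp add: step_def)
next
  case (eval_PrimRecS f g n xs y z)
  from derivable_judg[OF _ eval_PrimRecS.IH] show ?case by (simp add: step_def)
next
  case (eval_Minim f n xs)
  have "\<forall>m<n. \<exists>y. derivable (judg (code f) (lcons m (code_list xs)) (Suc y))"
    using eval_Minim.IH(2) by fastforce
  from derivable_judg[OF _ eval_Minim.IH(1) derivable_positive[OF this]] show ?case
    by (simp add: step_def)
qed

section \<open>Soundness: every derivable judgement about a program is an evaluation\<close>

text \<open>The induction invariant. The auxiliary tags 6 and 7 need clauses with their own intended
  meaning. All clauses are restricted to codes of actual programs, since \<open>step\<close> also
  derives judgements about other numbers, such as pairs with tag 0 and an arbitrary second
  component.\<close>

definition sound :: "nat \<Rightarrow> bool" where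
  "sound t \<longleftrightarrow>
    (\<forall>f xs z. t = judg (code f) (code_list xs) z \<longrightarrow> eval f xs z)
  \<and> (\<forall>gs xs z. t = judg (prod_encode (6, code_list (map code gs))) (code_list xs) z
      \<longrightarrow> (\<exists>ys. z = code_list ys \<and> list_all2 (\<lambda>g y. eval g xs y) gs ys))
  \<and> (\<forall>f n xs z. t = judg (prod_encode (7, prod_encode (code f, n))) (code_list xs) z
      \<longrightarrow> (\<forall>m<n. \<exists>y. eval f (m # xs) (Suc y)))"

lemma soundD:
  assumes "sound t"
  shows "t = judg (code f) (code_list xs) z \<Longrightarrow> eval f xs z"
    and "t = judg (prod_encode (6, code_list (map code gs))) (code_list xs) z \<Longrightarrow>
      \<exists>ys. z = code_list ys \<and> list_all2 (\<lambda>g y. eval g xs y) gs ys"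
    and "t = judg (prod_encode (7, prod_encode (code f, n))) (code_list xs) z \<Longrightarrow> m < n \<Longrightarrow>
      \<exists>y. eval f (m # xs) (Suc y)"
  using assms unfolding sound_def by blast+

lemma eval_sound_step:
  assumes p: "sound p" and q: "sound q" and step: "step (code f) (code_list xs) z p q"
  shows "eval f xs z"
proof (cases f)
  case Zero
  then show ?thesis using step by (auto simp: step_def intro: eval_Zero)
next
  case Succ
  then show ?thesis using step by (cases xs) (auto simp: step_def intro: eval_Succ)
next
  case (Proj i)
  then obtain x ys where xs: "xs = x # ys" using step by (cases xs) (auto simp: step_def)
  show ?thesis
  proof (cases i)
    case 0
    then show ?thesis using step Proj xs eval.eval_Proj[of 0 xs] by (auto simp: step_def)
  next
    case (Suc j)
    then have "p = judg (code (recf.Proj j)) (code_list ys) z"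
      using step Proj xs by (auto simp: step_def)
    then have "eval (recf.Proj j) ys z" by (rule soundD(1)[OF p])
    then have "j < length ys" "z = ys ! j" by (auto elim: eval_ProjE)
    then show ?thesis using eval.eval_Proj[of i xs] Proj Suc xs by auto
  qed
next
  case (Comp h gs)
  \<comment> \<open>The intermediate value is read off the premise \<open>p\<close> itself, which
    keeps \<open>step\<close> free of quantifiers.\<close>
  let ?w = "psnd (psnd p)"
  have 1: "p = judg (prod_encode (6, code_list (map code gs))) (code_list xs) ?w"
    and 2: "q = judg (code h) ?w z"
    using step Comp by (auto simp: step_def)
  obtain ys where ys: "?w = code_list ys" "list_all2 (\<lambda>g y. eval g xs y) gs ys"
    using soundD(2)[OF p 1] by blast
  have "eval h ys z" using soundD(1)[OF q, of h ys z] 2 ys(1) by simp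
  then show ?thesis unfolding Comp by (rule eval_Comp[OF ys(2)])
next
  case (PrimRec h g)
  then obtain x ys where xs: "xs = x # ys" using step by (cases xs) (auto simp: step_def)
  show ?thesis
  proof (cases x)
    case 0
    then have "p = judg (code h) (code_list ys) z" using step PrimRec xs by (auto simp: step_def)
    from soundD(1)[OF p this] show ?thesis using PrimRec xs 0 by (auto intro: eval_PrimRec0)
  next
    case (Suc n)
    let ?w = "psnd (psnd p)"
    have 1: "p = judg (code f) (code_list (n # ys)) ?w"
      and 2: "q = judg (code g) (code_list (n # ?w # ys)) z"
      using step PrimRec xs Suc by (auto simp: step_def)
    show ?thesis
      using soundD(1)[OF p 1] soundD(1)[OF q 2] PrimRec xs Suc by (auto intro: eval_PrimRecS)
  qed
next
  case (Minim h)
  then have 1: "p = judg (code h) (code_list (z # xs)) 0"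
    and 2: "q = judg (prod_encode (7, prod_encode (code h, z))) (code_list xs) 0"
    using step by (auto simp: step_def)
  show ?thesis
    unfolding Minim using soundD(1)[OF p 1] soundD(3)[OF q 2] by (blast intro: eval_Minim)
qed

lemma list_sound_step:
  assumes p: "sound p" and q: "sound q"
    and step: "step (prod_encode (6, code_list (map code gs))) (code_list xs) z p q"
  shows "\<exists>ys. z = code_list ys \<and> list_all2 (\<lambda>g y. eval g xs y) gs ys"
proof (cases gs)
  case Nil
  then show ?thesis using step by (intro exI[of _ "[]"]) (auto simp: step_def)
next
  case (Cons g gs')
  then have z: "0 < z" and 1: "p = judg (code g) (code_list xs) (lhd z)"
    and 2: "q = judg (prod_encode (6, code_list (map code gs'))) (code_list xs) (ltl z)"
    using step by (auto simp: step_def)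
  obtain ys where ys: "ltl z = code_list ys" "list_all2 (\<lambda>g y. eval g xs y) gs' ys"
    using soundD(2)[OF q 2] by blast
  have "z = code_list (lhd z # ys)"
    using z by (simp flip: ys(1))
  then show ?thesis using Cons ys(2) soundD(1)[OF p 1] by (intro exI[of _ "lhd z # ys"]) simp
qed

lemma positive_sound_step:
  assumes p: "sound p" and q: "sound q"
    and step: "step (prod_encode (7, prod_encode (code f, n))) (code_list xs) z p q"
    and m: "m < n"
  shows "\<exists>y. eval f (m # xs) (Suc y)"
proof -
  let ?w = "psnd (psnd q)"
  have 1: "p = judg (prod_encode (7, prod_encode (code f, n - 1))) (code_list xs) z"
    and 2: "q = judg (code f) (code_list ((n - 1) # xs)) ?w" and w: "0 < ?w"
    using step m by (auto simp: step_def)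
  show ?thesis
  proof (cases "m = n - 1")
    case True
    then show ?thesis using soundD(1)[OF q 2] w by (metis Suc_pred)
  next
    case False
    then show ?thesis using soundD(3)[OF p 1] m by simp
  qed
qed

lemma sound_step:
  assumes "sound p" "sound q" "step (pfst t) (pfst (psnd t)) (psnd (psnd t)) p q"
  shows "sound t"
  unfolding sound_def
proof (intro conjI allI impI)
  fix f xs z assume "t = judg (code f) (code_list xs) z"
  then show "eval f xs z" using assms eval_sound_step by simp
next
  fix gs xs z assume "t = judg (prod_encode (6, code_list (map code gs))) (code_list xs) z"
  then show "\<exists>ys. z = code_list ys \<and> list_all2 (\<lambda>g y. eval g xs y) gs ys"
    using assms list_sound_step by simp
next
  fix f n xs z m
  assume "t = judg (prod_encode (7, prod_encode (code f, n))) (code_list xs) z" "m < n"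
  then show "\<exists>y. eval f (m # xs) (Suc y)" using assms positive_sound_step by simp
qed

lemma sound_0: "sound 0"
proof -
  have 0: "0 = judg (prod_encode (0, 0)) 0 0" by (simp add: prod_encode_def)
  \<comment> \<open>The judgement 0 has tag 0, so the clauses for tags 6 and 7 hold vacuously, and
    in the first clause the program can only be \<open>Zero\<close>.\<close>
  have "code f = prod_encode (0, 0) \<Longrightarrow> f = Zero" for f
    using code_inject[of f Zero] by simp
  then show ?thesis unfolding sound_def by (subst (1 2 3) 0) (auto intro: eval_Zero)
qed

lemma derivable_iff_eval: "derivable (judg (code f) (code_list xs) z) \<longleftrightarrow> eval f xs z"
proof
  have "sound t" if "derivable t" for t
    using that by induction (auto intro: sound_0 sound_step)
  then show "derivable (judg (code f) (code_list xs) z) \<Longrightarrow> eval f xs z"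
    using soundD(1) by blast
qed (rule derivable_complete)

text \<open>The bits of \<open>stage n\<close> are the judgements found after \<open>n\<close> steps. In step \<open>n\<close> the candidate
  \<open>pfst n\<close> is tried; each candidate is tried infinitely often.\<close>

primrec stage :: "nat \<Rightarrow> nat" where
  "stage 0 = 1"
| "stage (Suc n) =
    (if \<not> pfst n \<in> set_decode (stage n) \<and>
        (\<exists>p<stage n. \<exists>q<stage n. p \<in> set_decode (stage n) \<and> q \<in> set_decode (stage n) \<and>
          step (pfst (pfst n)) (pfst (psnd (pfst n))) (psnd (psnd (pfst n))) p q)
     then 2 ^ pfst n + stage n else stage n)"

text \<open>Shows that the bounded quantifiers over \<open>p\<close> and \<open>q\<close> in
  \<open>stage\<close> reach every judgement found so far.\<close>

lemma set_decode_less: "t \<in> set_decode s \<Longrightarrow> t < s"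
proof -
  assume "t \<in> set_decode s"
  then have "0 < s div 2 ^ t" by (auto simp: set_decode_def intro: odd_pos)
  then have "2 ^ t \<le> s" by (simp add: div_greater_zero_iff)
  then show "t < s" by (rule less_le_trans[OF less_exp])
qed

lemma set_decode_stage_Suc:
  "set_decode (stage (Suc n)) = set_decode (stage n) \<union>
    {t. t = pfst n \<and> (\<exists>p\<in>set_decode (stage n). \<exists>q\<in>set_decode (stage n).
      step (pfst t) (pfst (psnd t)) (psnd (psnd t)) p q)}"
  using set_decode_less[of _ "stage n"] by (auto simp: set_decode_plus_power_2)

lemma set_decode_stage_mono: "m \<le> n \<Longrightarrow> set_decode (stage m) \<subseteq> set_decode (stage n)"
  by (rule lift_Suc_mono_le[of "\<lambda>n. set_decode (stage n)"]) (simp only: set_decode_stage_Suc Un_upper1)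

lemma set_decode_1: "set_decode (Suc 0) = {0}"
  using set_decode_plus_power_2[of 0 0] by simp

lemma derivable_iff_stage: "derivable t \<longleftrightarrow> (\<exists>n. t \<in> set_decode (stage n))"
proof
  assume "derivable t"
  then show "\<exists>n. t \<in> set_decode (stage n)"
  proof induction
    case derivable_0
    show ?case by (rule exI[of _ 0]) (simp add: set_decode_1)
  next
    case (derivable_step p q t)
    then obtain m n where mn: "p \<in> set_decode (stage m)" "q \<in> set_decode (stage n)" by blast
    \<comment> \<open>At this step the candidate is \<open>t\<close>, and the step is late enough
      for both premises to be present.\<close>
    let ?N = "prod_encode (t, max m n)"
    have "m \<le> ?N" "n \<le> ?N" using le_prod_encode_2[of "max m n" t] by auto
    then have "p \<in> set_decode (stage ?N)" "q \<in> set_decode (stage ?N)"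
      using mn set_decode_stage_mono by blast+
    then have "t \<in> set_decode (stage (Suc ?N))"
      using derivable_step.hyps by (auto simp only: set_decode_stage_Suc prod_encode_inverse fst_conv)
    then show ?case by blast
  qed
next
  have "\<forall>t\<in>set_decode (stage n). derivable t" for n
  proof (induction n)
    case 0
    show ?case using derivable_0 by (simp add: set_decode_1)
  next
    case (Suc n)
    then show ?case by (auto simp only: set_decode_stage_Suc intro: derivable_step)
  qed
  then show "\<exists>n. t \<in> set_decode (stage n) \<Longrightarrow> derivable t" by blast
qed

section \<open>Computability of the stages and approximation of c.e. sets\<close>

lemma decidable_step:
  assumes "recursive k f1" "recursive k f2" "recursive k f3" "recursive k f4" "recursive k f5"
  shows "decidable k (\<lambda>e. step (f1 e) (f2 e) (f3 e) (f4 e) (f5 e))"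
proof -
  have "decidable 5 (\<lambda>e. step (e ! 0) (e ! 1) (e ! 2) (e ! 3) (e ! 4))"
    unfolding step_def by (intro recursive_intros; simp)
  then have "recursive k (\<lambda>e. (\<lambda>e. of_bool (step (e ! 0) (e ! 1) (e ! 2) (e ! 3) (e ! 4)))
      (map (\<lambda>f. f e) [f1, f2, f3, f4, f5]))"
    unfolding decidable_def
    by (intro recursive_compose) (use assms in \<open>auto simp: eval_nat_numeral\<close>)
  then show ?thesis by (simp add: decidable_def)
qed

text \<open>Unfolding \<open>stage_def\<close> exposes the underlying \<open>rec_nat\<close>, to
  which closure under primitive recursion applies.\<close>

lemma recursive_stage: "recursive k f \<Longrightarrow> recursive k (\<lambda>e. stage (f e))"
  unfolding stage_def by (intro recursive_intros decidable_step; simp)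

text \<open>Membership of \<open>x\<close> in the \<open>e\<close>-th c.e. set as seen at stage
  \<open>s\<close>; \<open>lcons x 0\<close> codes the list \<open>[x]\<close>. Bounding the output
  by \<open>s\<close> makes the relation decidable and keeps it monotone in
  \<open>s\<close>.\<close>

definition W_at :: "nat \<Rightarrow> nat \<Rightarrow> nat \<Rightarrow> bool" where
  "W_at s e x \<longleftrightarrow> (\<exists>z<s. judg e (lcons x 0) z \<in> set_decode (stage s))"

lemma W_at_mono: "W_at s e x \<Longrightarrow> s \<le> t \<Longrightarrow> W_at t e x"
  unfolding W_at_def using set_decode_stage_mono by (meson order_less_le_trans subsetD)

lemma mem_W_iff_W_at:
  assumes "e \<in> range code"
  shows "x \<in> W e \<longleftrightarrow> (\<exists>s. W_at s e x)"
proof -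
  obtain f where f: "e = code f" using assms by blast
  have "x \<in> W e \<longleftrightarrow> (\<exists>z s. judg e (lcons x 0) z \<in> set_decode (stage s))"
    using derivable_iff_eval[of f "[x]"] by (simp add: W_def f derivable_iff_stage)
  also have "\<dots> \<longleftrightarrow> (\<exists>s. W_at s e x)"
  proof
    assume "\<exists>z s. judg e (lcons x 0) z \<in> set_decode (stage s)"
    then obtain z s where "judg e (lcons x 0) z \<in> set_decode (stage s)" by blast
    \<comment> \<open>The stage is raised beyond \<open>z\<close> to meet the bound on the output in
      \<open>W_at\<close>.\<close>
    then have "judg e (lcons x 0) z \<in> set_decode (stage (max s (Suc z)))"
      using set_decode_stage_mono[of s "max s (Suc z)"] by auto
    then have "W_at (max s (Suc z)) e x"
      unfolding W_at_def by (intro exI[of _ z]) auto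
    then show "\<exists>s. W_at s e x" by blast
  qed (auto simp: W_at_def)
  finally show ?thesis .
qed

lemma decidable_W_at:
  assumes "recursive k f1" "recursive k f2" "recursive k f3"
  shows "decidable k (\<lambda>e. W_at (f1 e) (f2 e) (f3 e))"
proof -
  have "decidable 3 (\<lambda>e. W_at (e ! 0) (e ! 1) (e ! 2))"
    unfolding W_at_def by (intro recursive_intros recursive_stage; simp)
  then show ?thesis
    unfolding decidable_def
    by (rule recursive_compose3[where h = "\<lambda>x y z. of_bool (W_at x y z)"]) (simp_all add: assms)
qed

section \<open>The recursion theorem for c.e. sets\<close>

text \<open>Constant programs serve to hard-wire an argument, as in the s-m-n theorem.\<close>

primrec const_prog :: "nat \<Rightarrow> recf" where
  "const_prog 0 = Zero"
| "const_prog (Suc n) = Comp Succ [const_prog n]"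

lemma eval_const_prog: "eval (const_prog n) xs n"
proof (induction n)
  case (Suc n)
  have "eval (Comp Succ [const_prog n]) xs (Suc n)"
    by (rule eval_Comp[of _ _ "[n]"]) (auto intro: Suc eval_Succ)
  then show ?case by simp
qed (auto intro: eval_Zero)

text \<open>The diagonal of the s-m-n function: if \<open>v\<close> codes \<open>f\<close>, the
  value codes the program that runs \<open>f\<close> on its input and \<open>v\<close>.\<close>

definition self_apply :: "nat \<Rightarrow> nat" where
  "self_apply v = prod_encode (3, prod_encode (v, code_list [code (Proj 0), code (const_prog v)]))"

lemma self_apply_code: "self_apply (code f) = code (Comp f [Proj 0, const_prog (code f)])"
  by (simp add: self_apply_def)

lemma recursive_self_apply:
  assumes "recursive k f"
  shows "recursive k (\<lambda>e. self_apply (f e))"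
proof -
  have "recursive k (\<lambda>e. rec_nat (code Zero)
    (\<lambda>n r. prod_encode (3, prod_encode (code Succ, lcons r 0))) (f e))"
    by (intro recursive_intros assms; simp)
  moreover have "rec_nat (code Zero) (\<lambda>n r. prod_encode (3, prod_encode (code Succ, lcons r 0))) n
    = code (const_prog n)" for n
    by (induction n) auto
  ultimately have "recursive k (\<lambda>e. code (const_prog (f e)))" by simp
  then show ?thesis
    unfolding self_apply_def code_list.simps by (intro recursive_intros assms)
qed

text \<open>Kleene's diagonal argument: \<open>Minim r\<close> searches for an \<open>s\<close> with
  \<open>Q s u (self_apply v)\<close>. When \<open>v\<close> is the code of \<open>Minim r\<close>
  itself, \<open>self_apply v\<close> is an index of the program being run.\<close>

lemma W_self_reference:
  assumes "decidable 3 (\<lambda>e. Q (e ! 0) (e ! 1) (e ! 2))"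
  obtains c where "\<And>u. u \<in> W c \<longleftrightarrow> (\<exists>s. Q s u c)"
proof -
  have "recursive 3 (\<lambda>e. of_bool (Q (e ! 0) (e ! 1) (self_apply (e ! 2))))"
    using assms unfolding decidable_def
    by (rule recursive_compose3[where h = "\<lambda>x y z. of_bool (Q x y z)"])
      (simp_all add: recursive_nth recursive_self_apply)
  \<comment> \<open>The negation appears because \<open>Minim\<close> searches for a zero.\<close>
  then have "decidable 3 (\<lambda>e. \<not> Q (e ! 0) (e ! 1) (self_apply (e ! 2)))"
    by (intro decidable_not) (simp add: decidable_def)
  then obtain r where r: "\<And>xs. length xs = 3 \<Longrightarrow>
      eval r xs (of_bool (\<not> Q (xs ! 0) (xs ! 1) (self_apply (xs ! 2))))"
    by (auto simp: decidable_def recursive_def)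
  have r: "eval r [s, u, v] (of_bool (\<not> Q s u (self_apply v)))" for s u v
    using r[of "[s, u, v]"] by (simp add: numeral_2_eq_2)
  have eval_r: "eval r [s, u, v] w \<longleftrightarrow> w = of_bool (\<not> Q s u (self_apply v))" for s u v w
    using r eval_deterministic by blast
  let ?v = "code (Minim r)"
  let ?c = "self_apply ?v"
  have "u \<in> W ?c \<longleftrightarrow> (\<exists>s. Q s u ?c)" for u
  proof -
    have args: "list_all2 (\<lambda>g y. eval g [u] y) [Proj 0, const_prog ?v] ys \<longleftrightarrow> ys = [u, ?v]" for ys
      using eval_Proj[of 0 "[u]"] eval_const_prog[of ?v "[u]"]
      by (auto simp: list_all2_Cons1 intro: eval_deterministic)
    have "u \<in> W ?c \<longleftrightarrow> (\<exists>z. eval (Comp (Minim r) [Proj 0, const_prog ?v]) [u] z)"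
      unfolding W_def self_apply_code prog_code by simp
    also have "\<dots> \<longleftrightarrow> (\<exists>z. eval (Minim r) [u, ?v] z)"
      by (metis args eval_Comp eval_CompE)
    also have "\<dots> \<longleftrightarrow> (\<exists>s. Q s u ?c)"
    proof
      assume "\<exists>s. Q s u ?c"
      \<comment> \<open>The least witness is taken, since \<open>Minim\<close> requires positive
        values at all smaller arguments.\<close>
      then obtain s where s: "Q s u ?c" and least: "\<And>m. m < s \<Longrightarrow> \<not> Q m u ?c"
        using exists_least_iff[of "\<lambda>s. Q s u ?c"] by blast
      have "eval (Minim r) [u, ?v] s"
        by (rule eval_Minim) (use s least in \<open>auto simp: eval_r\<close>)
      then show "\<exists>z. eval (Minim r) [u, ?v] z" by blast
    next
      assume "\<exists>z. eval (Minim r) [u, ?v] z"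
      then obtain z where "eval r [z, u, ?v] 0" by (auto elim: eval_MinimE)
      then show "\<exists>s. Q s u ?c" by (auto simp: eval_r)
    qed
    finally show ?thesis .
  qed
  then show thesis by (rule that)
qed

section \<open>Families of initial segments\<close>

text \<open>The shortest length \<open>p\<close> is a parameter so that the empty set can be kept in
  the family (\<open>p = 0\<close>) or left out (\<open>p = 1\<close>).\<close>

definition segments :: "nat \<Rightarrow> nat set set" where
  "segments p = range (\<lambda>k. {..<p + k})"

lemma UNIV_notin_segments: "UNIV \<notin> segments p"
proof
  assume "UNIV \<in> segments p"
  then obtain k where "(UNIV :: nat set) = {..<p + k}" by (auto simp: segments_def)
  then show False by (metis finite_lessThan infinite_UNIV_nat)
qed

text \<open>The least number missing from \<open>S\<close> is the length of the segment.\<close>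

lemma down_closed_in_segments:
  assumes down: "\<And>x y. x \<in> S \<Longrightarrow> y \<le> x \<Longrightarrow> y \<in> S" and "{..<p} \<subseteq> S" and "S \<noteq> UNIV"
  shows "S \<in> segments p"
proof -
  obtain n where n: "n \<notin> S" "\<And>m. m < n \<Longrightarrow> m \<in> S"
    using \<open>S \<noteq> UNIV\<close> exists_least_iff[of "\<lambda>n. n \<notin> S"] by blast
  have "S = {..<n}" using n down by (auto simp: not_less[symmetric])
  moreover have "p \<le> n" using n(1) \<open>{..<p} \<subseteq> S\<close> by (auto simp: not_less[symmetric])
  ultimately show ?thesis unfolding segments_def by (intro image_eqI[of _ _ "n - p"]) auto
qed

text \<open>Read \<open>D t y\<close> as "\<open>y\<close> is enumerated by stage \<open>t\<close>".
  The number \<open>x\<close> bounds both the elements and the stages to be matched, and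
  \<open>s\<close> is the stage at which their matches have appeared, so "for all \<open>x\<close>
  there is \<open>s\<close>" is the \<open>\<Pi>\<^sub>2\<close> form. The condition passes to
  smaller \<open>x\<close>, and the clause \<open>x < p\<close> gives the resulting segment length
  at least \<open>p\<close>.\<close>

definition agreement :: "nat \<Rightarrow> (nat \<Rightarrow> nat \<Rightarrow> bool) \<Rightarrow> (nat \<Rightarrow> nat \<Rightarrow> bool) \<Rightarrow> nat \<Rightarrow> nat \<Rightarrow> nat \<Rightarrow> bool" where
  "agreement p D E k s x \<longleftrightarrow> x < p \<or> (\<forall>y<Suc x. k < y \<longrightarrow>
    (\<forall>t<Suc x. (D t y \<longrightarrow> E s y) \<and> (E t y \<longrightarrow> D s y)))"

lemma agreement_down: "agreement p D E k s x \<Longrightarrow> y \<le> x \<Longrightarrow> agreement p D E k s y"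
  unfolding agreement_def by (meson Suc_le_mono le_less_trans less_le_trans)

text \<open>That two sets enumerated by \<open>D\<close> and \<open>E\<close> agree beyond \<open>k\<close> is a \<open>\<Pi>\<^sub>2\<close> condition, and hence
  amounts to the infinitude of a c.e. set.\<close>

lemma agreement_UNIV_iff:
  assumes D: "\<And>s t y. D s y \<Longrightarrow> s \<le> t \<Longrightarrow> D t y" and E: "\<And>s t y. E s y \<Longrightarrow> s \<le> t \<Longrightarrow> E t y"
  shows "{x. \<exists>s. agreement p D E k s x} = UNIV \<longleftrightarrow> (\<forall>y>k. (\<exists>s. D s y) \<longleftrightarrow> (\<exists>s. E s y))"
proof
  assume *: "{x. \<exists>s. agreement p D E k s x} = UNIV"
  have "(D t y \<longrightarrow> (\<exists>s. E s y)) \<and> (E t y \<longrightarrow> (\<exists>s. D s y))" if "y > k" for t y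
  proof -
    \<comment> \<open>This number is not below \<open>p\<close>, and it is large enough to cover
      both the element \<open>y\<close> and the stage \<open>t\<close>.\<close>
    obtain s where s: "agreement p D E k s (p + y + t)" using * by blast
    have "\<not> p + y + t < p" "y < Suc (p + y + t)" "t < Suc (p + y + t)" by auto
    then have "(D t y \<longrightarrow> E s y) \<and> (E t y \<longrightarrow> D s y)"
      using s that unfolding agreement_def by blast
    then show ?thesis by blast
  qed
  then show "\<forall>y>k. (\<exists>s. D s y) \<longleftrightarrow> (\<exists>s. E s y)" by blast
next
  assume *: "\<forall>y>k. (\<exists>s. D s y) \<longleftrightarrow> (\<exists>s. E s y)"
  \<comment> \<open>Finitely many elements need only one common stage, the maximum of their
    individual stages by monotonicity.\<close>
  have "\<exists>s. \<forall>y<x. k < y \<longrightarrow> (\<exists>t. D t y \<or> E t y) \<longrightarrow> D s y \<and> E s y" for x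
  proof (induction x)
    case (Suc x)
    then obtain s where s: "\<And>y. y < x \<Longrightarrow> k < y \<Longrightarrow> (\<exists>t. D t y \<or> E t y) \<Longrightarrow> D s y \<and> E s y"
      by blast
    obtain s' where s': "k < x \<Longrightarrow> (\<exists>t. D t x \<or> E t x) \<Longrightarrow> D s' x \<and> E s' x"
    proof (cases "k < x \<and> (\<exists>t. D t x \<or> E t x)")
      case True
      then obtain t1 t2 where "D t1 x" "E t2 x" using * by blast
      then have "D (max t1 t2) x \<and> E (max t1 t2) x" using D E by (meson max.cobounded1 max.cobounded2)
      then show thesis by (intro that)
    qed (use that in blast)
    have "D (max s s') y \<and> E (max s s') y" if "y < Suc x" "k < y" "\<exists>t. D t y \<or> E t y" for y
      using s s' that D E by (metis less_Suc_eq max.cobounded1 max.cobounded2)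
    then show ?case by blast
  qed simp
  then show "{x. \<exists>s. agreement p D E k s x} = UNIV"
    unfolding agreement_def by (simp add: set_eq_iff) meson
qed

section \<open>Indices for the families and the diagonal index\<close>

lemma range_even_odd: "range (f :: nat \<Rightarrow> 'a) = range (\<lambda>k. f (2 * k)) \<union> range (\<lambda>k. f (2 * k + 1))"
proof -
  have "f n \<in> range (\<lambda>k. f (2 * k)) \<union> range (\<lambda>k. f (2 * k + 1))" for n
    by (cases "even n") (auto elim!: evenE oddE)
  then show ?thesis by auto
qed

lemma segments_index:
  obtains b where "range (column (W b)) = segments p"
proof -
  have "decidable 3 (\<lambda>e. pfst (e ! 1) < p + psnd (e ! 1))"
    by (intro recursive_intros; simp)
  then obtain b where "\<And>u. u \<in> W b \<longleftrightarrow> (\<exists>s::nat. pfst u < p + psnd u)"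
    using W_self_reference[of "\<lambda>s u v. pfst u < p + psnd u"] by blast
  then have "column (W b) = (\<lambda>k. {..<p + k})" by (auto simp: column_def fun_eq_iff)
  then show thesis by (intro that[of b]) (simp add: segments_def)
qed

lemma segments_UNIV_index:
  obtains a where "range (column (W a)) = insert UNIV (segments p)"
proof -
  have "decidable 3 (\<lambda>e. odd (psnd (e ! 1)) \<or> pfst (e ! 1) < p + psnd (e ! 1) div 2)"
    by (intro recursive_intros; simp)
  then obtain a where "\<And>u. u \<in> W a \<longleftrightarrow> (\<exists>s::nat. odd (psnd u) \<or> pfst u < p + psnd u div 2)"
    using W_self_reference[of "\<lambda>s u v. odd (psnd u) \<or> pfst u < p + psnd u div 2"] by blast
  then have "column (W a) (2 * k) = {..<p + k}" "column (W a) (2 * k + 1) = UNIV" for k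
    by (auto simp: column_def)
  then show thesis
    by (intro that[of a]) (subst range_even_odd, auto simp: segments_def)
qed

text \<open>Even columns list all of \<open>segments p\<close>; column \<open>2 * k + 1\<close>
  tests agreement beyond \<open>k\<close> and is full exactly if the test succeeds. The number
  \<open>b\<close> will be a value of the reduction. The condition is phrased with
  \<open>W_at\<close>, whose link to \<open>W\<close> holds for codes of programs.\<close>

lemma diagonal_index:
  assumes "computable g"
  obtains c where "range (column (W c)) =
    (if \<exists>k. \<forall>y>k. (\<exists>s. W_at s (g c) (prod_encode (y, n))) \<longleftrightarrow> (\<exists>s. W_at s b (prod_encode (y, n)))
     then insert UNIV (segments p) else segments p)"
proof -
  let ?V = "\<lambda>i s y. W_at s i (prod_encode (y, n))"
  let ?Q = "\<lambda>s u v. (\<not> odd (psnd u) \<and> pfst u < p + psnd u div 2) \<or>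
    (odd (psnd u) \<and> agreement p (?V (g v)) (?V b) (psnd u div 2) s (pfst u))"
  have "recursive 1 (\<lambda>e. g (e ! 0))"
    using assms by (fastforce simp: recursive_def computable_def length_Suc_conv)
  note g = recursive_compose1[OF this]
  have "decidable 3 (\<lambda>e. ?Q (e ! 0) (e ! 1) (e ! 2))"
    unfolding agreement_def by (intro recursive_intros decidable_W_at g; simp)
  then obtain c where c: "\<And>u. u \<in> W c \<longleftrightarrow> (\<exists>s. ?Q s u c)"
    using W_self_reference[of ?Q] by blast
  have even: "column (W c) (2 * k) = {..<p + k}" for k
    by (auto simp: column_def c)
  have odd: "column (W c) (2 * k + 1) = {x. \<exists>s. agreement p (?V (g c)) (?V b) k s x}" for k
    by (auto simp: column_def c)
  have UNIV_iff: "column (W c) (2 * k + 1) = UNIV \<longleftrightarrow>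
      (\<forall>y>k. (\<exists>s. ?V (g c) s y) \<longleftrightarrow> (\<exists>s. ?V b s y))" for k
    unfolding odd by (rule agreement_UNIV_iff) (auto intro: W_at_mono)
  \<comment> \<open>A failed test leaves an initial segment that the even columns already
    provide.\<close>
  have segment: "column (W c) (2 * k + 1) \<in> segments p" if "column (W c) (2 * k + 1) \<noteq> UNIV" for k
  proof (rule down_closed_in_segments[OF _ _ that])
    show "y \<in> column (W c) (2 * k + 1)" if "x \<in> column (W c) (2 * k + 1)" "y \<le> x" for x y
      using that agreement_down unfolding odd by blast
    show "{..<p} \<subseteq> column (W c) (2 * k + 1)" unfolding odd by (auto simp: agreement_def)
  qed
  have "range (column (W c)) = segments p \<union> range (\<lambda>k. column (W c) (2 * k + 1))"
    by (subst range_even_odd) (simp only: even segments_def)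
  also have "\<dots> = (if \<exists>k. column (W c) (2 * k + 1) = UNIV
      then insert UNIV (segments p) else segments p)"
    using segment by auto
  finally show thesis by (intro that[of c]) (simp only: UNIV_iff)
qed

section \<open>Almost equality of columns and the final contradiction\<close>

lemma almost_equal_iff:
  fixes A B :: "nat set"
  shows "finite ((A - B) \<union> (B - A)) \<longleftrightarrow> (\<exists>k. \<forall>y>k. y \<in> A \<longleftrightarrow> y \<in> B)"
  unfolding finite_nat_set_iff_bounded_le by (auto simp: not_less[symmetric])

lemma almost_equal_trans:
  assumes "finite ((A - B) \<union> (B - A))" "finite ((B - C) \<union> (C - B))"
  shows "finite ((A - C) \<union> (C - A))"
  using finite_UnI[OF assms] by (rule rev_finite_subset) blast

text \<open>An index that codes no program stands for \<open>UNIV\<close>, which \<^const>\<open>W_at\<close> does not see. All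
  such values of a reduction are equivalent, so they occur on one class only, and that class
  contains the empty set as a column or not.\<close>

lemma reduction_yields_codes:
  assumes g: "\<And>x y. Ece_set x y \<longleftrightarrow> Ece_3 (g x) (g y)"
  obtains p where "\<forall>x. range (column (W x)) = segments p \<or>
    range (column (W x)) = insert UNIV (segments p) \<longrightarrow> g x \<in> range code"
proof (cases "\<exists>x. g x \<notin> range code")
  case True
  then obtain x0 where x0: "g x0 \<notin> range code" by blast
  \<comment> \<open>The choice makes both families differ from that of \<open>x0\<close> on whether
    the empty set occurs.\<close>
  define p :: nat where "p = (if {} \<in> range (column (W x0)) then 1 else 0)"
  have "{} \<in> segments 0" "{} \<notin> segments 1" by (auto simp: segments_def)
  then have p: "range (column (W x0)) \<noteq> segments p" "range (column (W x0)) \<noteq> insert UNIV (segments p)"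
    by (auto simp: p_def)
  have "g x \<in> range code" if "range (column (W x)) = segments p \<or>
    range (column (W x)) = insert UNIV (segments p)" for x
  proof (rule ccontr)
    assume "g x \<notin> range code"
    \<comment> \<open>\<open>prog\<close> has the default value \<open>Zero\<close> on both
      indices.\<close>
    then have "W (g x) = W (g x0)" using x0 by (simp add: W_def prog_def)
    then have "Ece_set x x0" by (simp add: g Ece_3_def)
    then show False using that p by (auto simp: Ece_set_def)
  qed
  then show thesis by (intro that allI impI)
qed (use that in blast)

theorem theorem2p6:
  shows "\<not> comp_reducible Ece_set Ece_3"
proof
  assume "comp_reducible Ece_set Ece_3"
  then obtain g where "computable g" and g: "\<And>x y. Ece_set x y \<longleftrightarrow> Ece_3 (g x) (g y)"
    by (auto simp: comp_reducible_def)
  obtain p where p: "\<forall>x. range (column (W x)) = segments p \<or>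
    range (column (W x)) = insert UNIV (segments p) \<longrightarrow> g x \<in> range code"
    by (rule reduction_yields_codes[OF g])
  obtain a where a: "range (column (W a)) = insert UNIV (segments p)" by (rule segments_UNIV_index)
  obtain b where b: "range (column (W b)) = segments p" by (rule segments_index)
  have "\<not> Ece_3 (g a) (g b)"
    unfolding g[symmetric] Ece_set_def a b using UNIV_notin_segments[of p] by blast
  let ?eq = "\<lambda>n i j. finite ((column (W i) n - column (W j) n) \<union> (column (W j) n - column (W i) n))"
  from \<open>\<not> Ece_3 (g a) (g b)\<close> obtain n where n: "\<not> ?eq n (g a) (g b)"
    unfolding Ece_3_def by blast
  obtain c where c: "range (column (W c)) =
    (if \<exists>k. \<forall>y>k. (\<exists>s. W_at s (g c) (prod_encode (y, n))) \<longleftrightarrow> (\<exists>s. W_at s (g b) (prod_encode (y, n)))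
     then insert UNIV (segments p) else segments p)" (is "_ = (if ?agree c then _ else _)")
    by (rule diagonal_index[OF \<open>computable g\<close>])
  \<comment> \<open>In either case the family of \<open>c\<close> is one of the two covered by
    \<open>p\<close>, so this is available before the case is decided.\<close>
  have "g c \<in> range code"
    by (rule p[rule_format, of c], cases "?agree c") (simp_all only: c if_True if_False simp_thms)
  moreover have "g b \<in> range code"
    by (rule p[rule_format, of b]) (simp only: b simp_thms)
  ultimately have "column (W (g c)) n = {y. \<exists>s. W_at s (g c) (prod_encode (y, n))}"
    "column (W (g b)) n = {y. \<exists>s. W_at s (g b) (prod_encode (y, n))}"
    unfolding column_def by (simp_all only: mem_W_iff_W_at)
  with c have c: "range (column (W c)) =
      (if ?eq n (g c) (g b) then insert UNIV (segments p) else segments p)"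
    unfolding almost_equal_iff by (simp only: mem_Collect_eq)
  show False
  proof (cases "?eq n (g c) (g b)")
    case True
    then have "Ece_set a c" using a c by (simp only: Ece_set_def if_True)
    then have "?eq n (g a) (g c)" unfolding g Ece_3_def by (rule spec)
    \<comment> \<open>Column \<open>n\<close> of \<open>g a\<close> almost agrees with that of
      \<open>g c\<close>, hence with that of \<open>g b\<close>, against the choice of
      \<open>n\<close>.\<close>
    from almost_equal_trans[OF this True] n show False by contradiction
  next
    case False
    then have "Ece_set c b" using b c by (simp only: Ece_set_def if_False)
    then have "?eq n (g c) (g b)" unfolding g Ece_3_def by (rule spec)
    with False show False by contradiction
  qed
qed

end
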